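(* Let $G:\mathcal{D}\to\mathcal{C}$ be a right adjoint of $F:\mathcal{C}\to\mathcal{D}$, with unit $\eta:1_{\mathcal{C}}\to GF$ and counit $\varepsilon:FG\to 1_{\mathcal{D}}$, and let $H:\mathcal{C}\to\mathcal{E}$ and $K:\mathcal{D}\to\mathcal{E}$ be functors. Then: 1) $F$ is $H$-separable if and only if there exists a natural transformation $\nu:HGF\to H$ such that $\nu_C\circ H(\eta_C)=I_{H(C)}$ for every $C\in\mathcal{C}$. 2) $G$ is $K$-separable if and only if there exists a natural transformation $\zeta:K\to KFG$ such that $K(\varepsilon_D)\circ\zeta_D=I_{K(D)}$ for every $D\in\mathcal{D}$.
   Context: For functors $F:\mathcal{C}\to\mathcal{D}$ and $H:\mathcal{C}\to\mathcal{E}$, $F$ is called $H$-separable if there is a family of maps $\mathcal{P}_{C,C'}:\mathrm{Hom}_{\mathcal{D}}(F(C),F(C'))\to\mathrm{Hom}_{\mathcal{E}}(H(C),H(C'))$, natural in $C,C'\in\mathcal{C}$ (i.e. $\mathcal{P}_{X,T}(F(v)\circ h\circ F(u))=H(v)\circ\mathcal{P}_{Y,Z}(h)\circ H(u)$ for all $u:X\to Y$, $v:Z\to T$ in $\mathcal{C}$ and $h:F(Y)\to F(Z)$ in $\mathcal{D}$), with $\mathcal{P}_{C,C'}(F(f))=H(f)$ for all $f:C\to C'$ in $\mathcal{C}$. $I_X$ denotes the identity of $X$. *)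

theory Defs
  imports Main
begin

record ('o, 'm) category =
  Obj :: "'o set"
  Arr :: "'m set"
  Dom :: "'m \<Rightarrow> 'o"
  Cod :: "'m \<Rightarrow> 'o"
  Ident :: "'o \<Rightarrow> 'm"
  Comp :: "'m \<Rightarrow> 'm \<Rightarrow> 'm" (infixl "\<cdot>\<index>" 70)

definition Hom :: "('o, 'm) category \<Rightarrow> 'o \<Rightarrow> 'o \<Rightarrow> 'm set" where
  "Hom C X Y = {f \<in> Arr C. Dom C f = X \<and> Cod C f = Y}"

locale category =
  fixes C :: "('o, 'm) category" (structure)
  assumes Dom_in_Obj: "f \<in> Arr C \<Longrightarrow> Dom C f \<in> Obj C"
    and Cod_in_Obj: "f \<in> Arr C \<Longrightarrow> Cod C f \<in> Obj C"
    and Ident_in_Hom: "X \<in> Obj C \<Longrightarrow> Ident C X \<in> Hom C X X"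
    and Comp_in_Hom: "f \<in> Hom C X Y \<Longrightarrow> g \<in> Hom C Y Z \<Longrightarrow> g \<cdot> f \<in> Hom C X Z"
    and Comp_Ident_left: "f \<in> Hom C X Y \<Longrightarrow> Ident C Y \<cdot> f = f"
    and Comp_Ident_right: "f \<in> Hom C X Y \<Longrightarrow> f \<cdot> Ident C X = f"
    and Comp_assoc: "f \<in> Hom C W X \<Longrightarrow> g \<in> Hom C X Y \<Longrightarrow> h \<in> Hom C Y Z \<Longrightarrow>
      (h \<cdot> g) \<cdot> f = h \<cdot> (g \<cdot> f)"

record ('o1, 'm1, 'o2, 'm2) cfunctor =
  on_Obj :: "'o1 \<Rightarrow> 'o2"
  on_Arr :: "'m1 \<Rightarrow> 'm2"

locale cfunctor = C: category C + D: category D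
  for C :: "('o1, 'm1) category" and D :: "('o2, 'm2) category" +
  fixes F :: "('o1, 'm1, 'o2, 'm2) cfunctor"
  assumes on_Obj_in_Obj: "X \<in> Obj C \<Longrightarrow> on_Obj F X \<in> Obj D"
    and on_Arr_in_Hom: "f \<in> Hom C X Y \<Longrightarrow> on_Arr F f \<in> Hom D (on_Obj F X) (on_Obj F Y)"
    and on_Arr_Ident: "X \<in> Obj C \<Longrightarrow> on_Arr F (Ident C X) = Ident D (on_Obj F X)"
    and on_Arr_Comp: "f \<in> Hom C X Y \<Longrightarrow> g \<in> Hom C Y Z \<Longrightarrow>
      on_Arr F (g \<cdot>\<^bsub>C\<^esub> f) = on_Arr F g \<cdot>\<^bsub>D\<^esub> on_Arr F f"

definition id_functor :: "('o, 'm, 'o, 'm) cfunctor" where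
  "id_functor = \<lparr>on_Obj = (\<lambda>X. X), on_Arr = (\<lambda>f. f)\<rparr>"

definition comp_functor ::
  "('o2, 'm2, 'o3, 'm3) cfunctor \<Rightarrow> ('o1, 'm1, 'o2, 'm2) cfunctor \<Rightarrow>
   ('o1, 'm1, 'o3, 'm3) cfunctor" (infixl "\<circ>\<^sub>F" 55) where
  "G \<circ>\<^sub>F F = \<lparr>on_Obj = (\<lambda>X. on_Obj G (on_Obj F X)), on_Arr = (\<lambda>f. on_Arr G (on_Arr F f))\<rparr>"

locale natural_transformation = F: cfunctor C D F + G: cfunctor C D G
  for C :: "('o1, 'm1) category" and D :: "('o2, 'm2) category"
    and F :: "('o1, 'm1, 'o2, 'm2) cfunctor" and G :: "('o1, 'm1, 'o2, 'm2) cfunctor" +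
  fixes \<tau> :: "'o1 \<Rightarrow> 'm2"
  assumes component_in_Hom: "X \<in> Obj C \<Longrightarrow> \<tau> X \<in> Hom D (on_Obj F X) (on_Obj G X)"
    and naturality: "f \<in> Hom C X Y \<Longrightarrow>
      \<tau> Y \<cdot>\<^bsub>D\<^esub> on_Arr F f = on_Arr G f \<cdot>\<^bsub>D\<^esub> \<tau> X"

text \<open>\<open>adjunction C D F G \<eta> \<epsilon>\<close>: the functor \<open>G\<close> is right adjoint to \<open>F\<close>, with unit \<open>\<eta>\<close> and
  counit \<open>\<epsilon>\<close>.\<close>

locale adjunction = F: cfunctor C D F + G: cfunctor D C G
    + unit: natural_transformation C C id_functor "G \<circ>\<^sub>F F" \<eta>
    + counit: natural_transformation D D "F \<circ>\<^sub>F G" id_functor \<epsilon>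
  for C :: "('o1, 'm1) category" and D :: "('o2, 'm2) category"
    and F :: "('o1, 'm1, 'o2, 'm2) cfunctor" and G :: "('o2, 'm2, 'o1, 'm1) cfunctor"
    and \<eta> :: "'o1 \<Rightarrow> 'm1" and \<epsilon> :: "'o2 \<Rightarrow> 'm2" +
  assumes triangle_left: "X \<in> Obj C \<Longrightarrow>
      \<epsilon> (on_Obj F X) \<cdot>\<^bsub>D\<^esub> on_Arr F (\<eta> X) = Ident D (on_Obj F X)"
    and triangle_right: "Y \<in> Obj D \<Longrightarrow>
      on_Arr G (\<epsilon> Y) \<cdot>\<^bsub>C\<^esub> \<eta> (on_Obj G Y) = Ident C (on_Obj G Y)"

text \<open>\<open>separable C D E F H\<close>: the functor \<open>F\<close> from \<open>C\<close> to \<open>D\<close> is \<open>H\<close>-separable, where \<open>H\<close> goes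
  from \<open>C\<close> to \<open>E\<close>. The family \<open>P\<close> is indexed by pairs of objects of \<open>C\<close>, since \<open>F\<close> need not be
  injective on objects.\<close>

definition separable ::
  "('o1, 'm1) category \<Rightarrow> ('o2, 'm2) category \<Rightarrow> ('o3, 'm3) category \<Rightarrow>
   ('o1, 'm1, 'o2, 'm2) cfunctor \<Rightarrow> ('o1, 'm1, 'o3, 'm3) cfunctor \<Rightarrow> bool" where
  "separable C D E F H \<longleftrightarrow> (\<exists>P :: 'o1 \<Rightarrow> 'o1 \<Rightarrow> 'm2 \<Rightarrow> 'm3.
     (\<forall>X \<in> Obj C. \<forall>Y \<in> Obj C. \<forall>h \<in> Hom D (on_Obj F X) (on_Obj F Y).
        P X Y h \<in> Hom E (on_Obj H X) (on_Obj H Y)) \<and>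
     (\<forall>X \<in> Obj C. \<forall>Y \<in> Obj C. \<forall>Z \<in> Obj C. \<forall>T \<in> Obj C.
        \<forall>u \<in> Hom C X Y. \<forall>v \<in> Hom C Z T. \<forall>h \<in> Hom D (on_Obj F Y) (on_Obj F Z).
          P X T (on_Arr F v \<cdot>\<^bsub>D\<^esub> h \<cdot>\<^bsub>D\<^esub> on_Arr F u) =
          on_Arr H v \<cdot>\<^bsub>E\<^esub> P Y Z h \<cdot>\<^bsub>E\<^esub> on_Arr H u) \<and>
     (\<forall>X \<in> Obj C. \<forall>Y \<in> Obj C. \<forall>f \<in> Hom C X Y. P X Y (on_Arr F f) = on_Arr H f))"

end

theory Submission
  imports Defs
begin

text \<open>
  The argument is of Yoneda type. Under the adjunction every \<open>h: F X \<rightarrow> F Y\<close> factors as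
  \<open>h = \<epsilon> (F Y) \<circ> F (G h \<circ> \<eta> X)\<close>, so a family \<open>P\<close> that is natural in its first argument satisfies
  \<open>P h = P (\<epsilon> (F Y)) \<circ> H (G h \<circ> \<eta> X)\<close> and is determined by its values \<open>\<nu> Y = P (\<epsilon> (F Y))\<close> on the
  counit. Naturality of \<open>P\<close> in its second argument makes \<open>\<nu>\<close> a natural transformation from \<open>HGF\<close>
  to \<open>H\<close>, and the condition \<open>P (F f) = H f\<close> at \<open>f = id\<close> becomes \<open>\<nu> X \<circ> H (\<eta> X) = id\<close> by the
  triangle identity for \<open>F\<close>. Conversely, any such \<open>\<nu>\<close> yields a family through the displayed formula
  for \<open>P h\<close>; that it sends \<open>F f\<close> to \<open>H f\<close> is the naturality of \<open>\<eta>\<close> followed by the splitting. This is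
  \<open>separable_left_adjoint_iff\<close>.

  The statement about \<open>G\<close> is the same statement in the opposite categories: there \<open>G\<close> is the left
  adjoint, with unit \<open>\<epsilon>\<close> and counit \<open>\<eta>\<close>, while separability does not change because reversing
  arrows only exchanges the two arguments of the family \<open>P\<close> (\<open>separable_opposite_iff\<close>).
\<close>

section \<open>Families natural in each argument separately\<close>

text \<open>
  Splitting the two-sided naturality condition into a precomposition and a postcomposition law
  removes the bracketing of triple composites. The two laws are what the construction of a natural
  transformation uses, and reversing arrows simply exchanges them.
\<close>

locale separating_family = F: cfunctor C D F + H: cfunctor C E H
  for C :: "('o1, 'm1) category" and D :: "('o2, 'm2) category" and E :: "('o3, 'm3) category"
    and F :: "('o1, 'm1, 'o2, 'm2) cfunctor" and H :: "('o1, 'm1, 'o3, 'm3) cfunctor" +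
  fixes P :: "'o1 \<Rightarrow> 'o1 \<Rightarrow> 'm2 \<Rightarrow> 'm3"
  assumes P_in_Hom: "X \<in> Obj C \<Longrightarrow> Y \<in> Obj C \<Longrightarrow> h \<in> Hom D (on_Obj F X) (on_Obj F Y) \<Longrightarrow>
      P X Y h \<in> Hom E (on_Obj H X) (on_Obj H Y)"
    and P_precomp: "u \<in> Hom C X Y \<Longrightarrow> Z \<in> Obj C \<Longrightarrow> h \<in> Hom D (on_Obj F Y) (on_Obj F Z) \<Longrightarrow>
      P X Z (h \<cdot>\<^bsub>D\<^esub> on_Arr F u) = P Y Z h \<cdot>\<^bsub>E\<^esub> on_Arr H u"
    and P_postcomp: "X \<in> Obj C \<Longrightarrow> v \<in> Hom C Y Z \<Longrightarrow> h \<in> Hom D (on_Obj F X) (on_Obj F Y) \<Longrightarrow>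
      P X Z (on_Arr F v \<cdot>\<^bsub>D\<^esub> h) = on_Arr H v \<cdot>\<^bsub>E\<^esub> P X Y h"
    and P_on_image: "f \<in> Hom C X Y \<Longrightarrow> P X Y (on_Arr F f) = on_Arr H f"

lemma (in category) Hom_objects:
  assumes "f \<in> Hom C X Y"
  shows "X \<in> Obj C" and "Y \<in> Obj C"
  using assms Dom_in_Obj Cod_in_Obj by (auto simp: Hom_def)

lemma separable_iff_separating_family:
  assumes F: "cfunctor C D F" and H: "cfunctor C E H"
  shows "separable C D E F H \<longleftrightarrow> (\<exists>P. separating_family C D E F H P)"
proof
  interpret F: cfunctor C D F by (rule F)
  interpret H: cfunctor C E H by (rule H)
  assume "separable C D E F H"
  then obtain P
    where typed: "\<forall>X \<in> Obj C. \<forall>Y \<in> Obj C. \<forall>h \<in> Hom D (on_Obj F X) (on_Obj F Y).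
        P X Y h \<in> Hom E (on_Obj H X) (on_Obj H Y)"
      and natural: "\<forall>X \<in> Obj C. \<forall>Y \<in> Obj C. \<forall>Z \<in> Obj C. \<forall>T \<in> Obj C.
        \<forall>u \<in> Hom C X Y. \<forall>v \<in> Hom C Z T. \<forall>h \<in> Hom D (on_Obj F Y) (on_Obj F Z).
          P X T (on_Arr F v \<cdot>\<^bsub>D\<^esub> h \<cdot>\<^bsub>D\<^esub> on_Arr F u) =
          on_Arr H v \<cdot>\<^bsub>E\<^esub> P Y Z h \<cdot>\<^bsub>E\<^esub> on_Arr H u"
      and image: "\<forall>X \<in> Obj C. \<forall>Y \<in> Obj C. \<forall>f \<in> Hom C X Y. P X Y (on_Arr F f) = on_Arr H f"
    unfolding separable_def by (elim exE conjE) (rule that)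
  note typed = typed[rule_format] and natural = natural[rule_format]
    and image = image[rule_format]
  have "separating_family C D E F H P"
  proof unfold_locales
    fix X Y h
    assume "X \<in> Obj C" "Y \<in> Obj C" "h \<in> Hom D (on_Obj F X) (on_Obj F Y)"
    then show "P X Y h \<in> Hom E (on_Obj H X) (on_Obj H Y)"
      by (rule typed)
  next
    fix u X Y Z h
    assume u: "u \<in> Hom C X Y" and Z: "Z \<in> Obj C"
      and h: "h \<in> Hom D (on_Obj F Y) (on_Obj F Z)"
    note XY = F.C.Hom_objects[OF u]
    have "P X Z (on_Arr F (Ident C Z) \<cdot>\<^bsub>D\<^esub> h \<cdot>\<^bsub>D\<^esub> on_Arr F u) =
        on_Arr H (Ident C Z) \<cdot>\<^bsub>E\<^esub> P Y Z h \<cdot>\<^bsub>E\<^esub> on_Arr H u"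
      by (rule natural[OF XY Z Z u F.C.Ident_in_Hom[OF Z] h])
    then show "P X Z (h \<cdot>\<^bsub>D\<^esub> on_Arr F u) = P Y Z h \<cdot>\<^bsub>E\<^esub> on_Arr H u"
      using F.D.Comp_Ident_left[OF h] H.D.Comp_Ident_left[OF typed[OF XY(2) Z h]]
      by (simp add: F.on_Arr_Ident[OF Z] H.on_Arr_Ident[OF Z])
  next
    fix X v Y Z h
    assume X: "X \<in> Obj C" and v: "v \<in> Hom C Y Z"
      and h: "h \<in> Hom D (on_Obj F X) (on_Obj F Y)"
    note YZ = F.C.Hom_objects[OF v]
    have "P X Z (on_Arr F v \<cdot>\<^bsub>D\<^esub> h \<cdot>\<^bsub>D\<^esub> on_Arr F (Ident C X)) =
        on_Arr H v \<cdot>\<^bsub>E\<^esub> P X Y h \<cdot>\<^bsub>E\<^esub> on_Arr H (Ident C X)"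
      by (rule natural[OF X X YZ F.C.Ident_in_Hom[OF X] v h])
    then show "P X Z (on_Arr F v \<cdot>\<^bsub>D\<^esub> h) = on_Arr H v \<cdot>\<^bsub>E\<^esub> P X Y h"
      using F.D.Comp_Ident_right[OF F.D.Comp_in_Hom[OF h F.on_Arr_in_Hom[OF v]]]
        H.D.Comp_Ident_right[OF H.D.Comp_in_Hom[OF typed[OF X YZ(1) h] H.on_Arr_in_Hom[OF v]]]
      by (simp add: F.on_Arr_Ident[OF X] H.on_Arr_Ident[OF X])
  next
    fix f X Y
    assume f: "f \<in> Hom C X Y"
    show "P X Y (on_Arr F f) = on_Arr H f"
      by (rule image[OF F.C.Hom_objects[OF f] f])
  qed
  then show "\<exists>P. separating_family C D E F H P" by blast
next
  assume "\<exists>P. separating_family C D E F H P"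
  then obtain P where "separating_family C D E F H P" by blast
  then interpret separating_family C D E F H P .
  have "P X T (on_Arr F v \<cdot>\<^bsub>D\<^esub> h \<cdot>\<^bsub>D\<^esub> on_Arr F u) = on_Arr H v \<cdot>\<^bsub>E\<^esub> P Y Z h \<cdot>\<^bsub>E\<^esub> on_Arr H u"
    if u: "u \<in> Hom C X Y" and v: "v \<in> Hom C Z T" and h: "h \<in> Hom D (on_Obj F Y) (on_Obj F Z)"
    for X Y Z T u v h
  proof -
    have "P X T (on_Arr F v \<cdot>\<^bsub>D\<^esub> h \<cdot>\<^bsub>D\<^esub> on_Arr F u) = P Y T (on_Arr F v \<cdot>\<^bsub>D\<^esub> h) \<cdot>\<^bsub>E\<^esub> on_Arr H u"
      by (rule P_precomp[OF u F.C.Hom_objects(2)[OF v]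
            F.D.Comp_in_Hom[OF h F.on_Arr_in_Hom[OF v]]])
    also have "P Y T (on_Arr F v \<cdot>\<^bsub>D\<^esub> h) = on_Arr H v \<cdot>\<^bsub>E\<^esub> P Y Z h"
      by (rule P_postcomp[OF F.C.Hom_objects(2)[OF u] v h])
    finally show ?thesis .
  qed
  then show "separable C D E F H"
    unfolding separable_def using P_in_Hom P_on_image by (intro exI[of _ P]) simp
qed

section \<open>Separability of a left adjoint\<close>

lemma cfunctor_comp_functor:
  assumes "cfunctor C D F" and "cfunctor D E G"
  shows "cfunctor C E (G \<circ>\<^sub>F F)"
proof -
  interpret F: cfunctor C D F by fact
  interpret G: cfunctor D E G by fact
  show ?thesis
  proof unfold_locales
    fix f g X Y Z
    assume f: "f \<in> Hom C X Y" and g: "g \<in> Hom C Y Z"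
    show "on_Arr (G \<circ>\<^sub>F F) (g \<cdot>\<^bsub>C\<^esub> f) = on_Arr (G \<circ>\<^sub>F F) g \<cdot>\<^bsub>E\<^esub> on_Arr (G \<circ>\<^sub>F F) f"
      using G.on_Arr_Comp[OF F.on_Arr_in_Hom[OF f] F.on_Arr_in_Hom[OF g]]
      by (simp add: comp_functor_def F.on_Arr_Comp[OF f g])
  qed (simp_all add: comp_functor_def F.on_Obj_in_Obj G.on_Obj_in_Obj F.on_Arr_in_Hom
      G.on_Arr_in_Hom F.on_Arr_Ident G.on_Arr_Ident)
qed

context adjunction
begin

lemma unit_in_Hom: "X \<in> Obj C \<Longrightarrow> \<eta> X \<in> Hom C X (on_Obj G (on_Obj F X))"
  using unit.component_in_Hom by (simp add: id_functor_def comp_functor_def)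

lemma counit_in_Hom: "Y \<in> Obj D \<Longrightarrow> \<epsilon> Y \<in> Hom D (on_Obj F (on_Obj G Y)) Y"
  using counit.component_in_Hom by (simp add: id_functor_def comp_functor_def)

lemma unit_naturality:
  "f \<in> Hom C X Y \<Longrightarrow> \<eta> Y \<cdot>\<^bsub>C\<^esub> f = on_Arr G (on_Arr F f) \<cdot>\<^bsub>C\<^esub> \<eta> X"
  using unit.naturality by (simp add: id_functor_def comp_functor_def)

lemma counit_naturality:
  "g \<in> Hom D X Y \<Longrightarrow> \<epsilon> Y \<cdot>\<^bsub>D\<^esub> on_Arr F (on_Arr G g) = g \<cdot>\<^bsub>D\<^esub> \<epsilon> X"
  using counit.naturality by (simp add: id_functor_def comp_functor_def)

text \<open>
  Evaluating the family on the counit at \<open>F X\<close> gives the component at \<open>X\<close>. Both legs of its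
  naturality square are the value of the family at the diagonal of the square that expresses
  naturality of \<open>\<epsilon>\<close> at \<open>F f\<close>.
\<close>

lemma splitting_of_separating_family:
  assumes "separating_family C D E F H P"
  defines "\<nu> \<equiv> \<lambda>X. P (on_Obj G (on_Obj F X)) X (\<epsilon> (on_Obj F X))"
  shows "natural_transformation C E (H \<circ>\<^sub>F G \<circ>\<^sub>F F) H \<nu>"
    and "X \<in> Obj C \<Longrightarrow> \<nu> X \<cdot>\<^bsub>E\<^esub> on_Arr H (\<eta> X) = Ident E (on_Obj H X)"
proof -
  interpret P: separating_family C D E F H P by fact
  interpret HGF: cfunctor C E "H \<circ>\<^sub>F G \<circ>\<^sub>F F"
    by (rule cfunctor_comp_functor[OF F.cfunctor_axioms
          cfunctor_comp_functor[OF G.cfunctor_axioms P.H.cfunctor_axioms]])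
  have GF_in_Obj: "on_Obj G (on_Obj F X) \<in> Obj C" if "X \<in> Obj C" for X
    by (rule G.on_Obj_in_Obj[OF F.on_Obj_in_Obj[OF that]])
  note counit_F = counit_in_Hom[OF F.on_Obj_in_Obj]
  show "natural_transformation C E (H \<circ>\<^sub>F G \<circ>\<^sub>F F) H \<nu>"
  proof unfold_locales
    fix X assume X: "X \<in> Obj C"
    show "\<nu> X \<in> Hom E (on_Obj (H \<circ>\<^sub>F G \<circ>\<^sub>F F) X) (on_Obj H X)"
      using P.P_in_Hom[OF GF_in_Obj[OF X] X counit_F[OF X]]
      by (simp add: \<nu>_def comp_functor_def)
  next
    fix f X Y assume f: "f \<in> Hom C X Y"
    note XY = F.C.Hom_objects[OF f]
    have "\<nu> Y \<cdot>\<^bsub>E\<^esub> on_Arr H (on_Arr G (on_Arr F f)) =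
        P (on_Obj G (on_Obj F X)) Y (\<epsilon> (on_Obj F Y) \<cdot>\<^bsub>D\<^esub> on_Arr F (on_Arr G (on_Arr F f)))"
      unfolding \<nu>_def
      by (rule P.P_precomp[OF G.on_Arr_in_Hom[OF F.on_Arr_in_Hom[OF f]] XY(2) counit_F[OF XY(2)],
            symmetric])
    also have "\<epsilon> (on_Obj F Y) \<cdot>\<^bsub>D\<^esub> on_Arr F (on_Arr G (on_Arr F f)) =
        on_Arr F f \<cdot>\<^bsub>D\<^esub> \<epsilon> (on_Obj F X)"
      by (rule counit_naturality[OF F.on_Arr_in_Hom[OF f]])
    also have "P (on_Obj G (on_Obj F X)) Y (on_Arr F f \<cdot>\<^bsub>D\<^esub> \<epsilon> (on_Obj F X)) =
        on_Arr H f \<cdot>\<^bsub>E\<^esub> \<nu> X"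
      unfolding \<nu>_def by (rule P.P_postcomp[OF GF_in_Obj[OF XY(1)] f counit_F[OF XY(1)]])
    finally show "\<nu> Y \<cdot>\<^bsub>E\<^esub> on_Arr (H \<circ>\<^sub>F G \<circ>\<^sub>F F) f = on_Arr H f \<cdot>\<^bsub>E\<^esub> \<nu> X"
      by (simp add: comp_functor_def)
  qed
  assume X: "X \<in> Obj C"
  have "\<nu> X \<cdot>\<^bsub>E\<^esub> on_Arr H (\<eta> X) = P X X (\<epsilon> (on_Obj F X) \<cdot>\<^bsub>D\<^esub> on_Arr F (\<eta> X))"
    unfolding \<nu>_def by (rule P.P_precomp[OF unit_in_Hom[OF X] X counit_F[OF X], symmetric])
  also have "\<dots> = P X X (on_Arr F (Ident C X))"
    by (simp add: triangle_left[OF X] F.on_Arr_Ident[OF X])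
  also have "\<dots> = Ident E (on_Obj H X)"
    by (simp add: P.P_on_image[OF F.C.Ident_in_Hom[OF X]] P.H.on_Arr_Ident[OF X])
  finally show "\<nu> X \<cdot>\<^bsub>E\<^esub> on_Arr H (\<eta> X) = Ident E (on_Obj H X)" .
qed

text \<open>
  The family sends \<open>h\<close> to \<open>\<nu> Y\<close> composed with \<open>H\<close> of the adjoint transpose \<open>G h \<circ> \<eta> X\<close> of \<open>h\<close>.
  Transposition turns precomposition with \<open>F u\<close> into precomposition with \<open>u\<close>, by naturality of
  \<open>\<eta>\<close>; postcomposition with \<open>F v\<close> becomes postcomposition with \<open>G (F v)\<close>, which \<open>\<nu>\<close> carries to
  \<open>H v\<close>.
\<close>

lemma separating_family_of_splitting:
  assumes "cfunctor C E H"
    and "natural_transformation C E (H \<circ>\<^sub>F G \<circ>\<^sub>F F) H \<nu>"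
    and split: "\<And>X. X \<in> Obj C \<Longrightarrow> \<nu> X \<cdot>\<^bsub>E\<^esub> on_Arr H (\<eta> X) = Ident E (on_Obj H X)"
  shows "separating_family C D E F H (\<lambda>X Y h. \<nu> Y \<cdot>\<^bsub>E\<^esub> on_Arr H (on_Arr G h \<cdot>\<^bsub>C\<^esub> \<eta> X))"
proof -
  interpret H: cfunctor C E H by fact
  interpret \<nu>: natural_transformation C E "H \<circ>\<^sub>F G \<circ>\<^sub>F F" H \<nu> by fact
  have \<nu>_in_Hom: "\<nu> X \<in> Hom E (on_Obj H (on_Obj G (on_Obj F X))) (on_Obj H X)"
    if "X \<in> Obj C" for X
    using \<nu>.component_in_Hom[OF that] by (simp add: comp_functor_def)
  have \<nu>_naturality: "\<nu> Y \<cdot>\<^bsub>E\<^esub> on_Arr H (on_Arr G (on_Arr F f)) = on_Arr H f \<cdot>\<^bsub>E\<^esub> \<nu> X"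
    if "f \<in> Hom C X Y" for f X Y
    using \<nu>.naturality[OF that] by (simp add: comp_functor_def)
  have transpose: "on_Arr G h \<cdot>\<^bsub>C\<^esub> \<eta> X \<in> Hom C X (on_Obj G Y)"
    if "X \<in> Obj C" and "h \<in> Hom D (on_Obj F X) Y" for X Y h
    by (rule F.C.Comp_in_Hom[OF unit_in_Hom[OF that(1)] G.on_Arr_in_Hom[OF that(2)]])
  show ?thesis
  proof unfold_locales
    fix X Y h
    assume "X \<in> Obj C" "Y \<in> Obj C" "h \<in> Hom D (on_Obj F X) (on_Obj F Y)"
    then show "\<nu> Y \<cdot>\<^bsub>E\<^esub> on_Arr H (on_Arr G h \<cdot>\<^bsub>C\<^esub> \<eta> X) \<in> Hom E (on_Obj H X) (on_Obj H Y)"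
      by (intro H.D.Comp_in_Hom[OF H.on_Arr_in_Hom[OF transpose] \<nu>_in_Hom])
  next
    fix u X Y Z h
    assume u: "u \<in> Hom C X Y" and Z: "Z \<in> Obj C"
      and h: "h \<in> Hom D (on_Obj F Y) (on_Obj F Z)"
    note XY = F.C.Hom_objects[OF u]
    note Fu = F.on_Arr_in_Hom[OF u]
    have "on_Arr G (h \<cdot>\<^bsub>D\<^esub> on_Arr F u) \<cdot>\<^bsub>C\<^esub> \<eta> X =
        on_Arr G h \<cdot>\<^bsub>C\<^esub> (on_Arr G (on_Arr F u) \<cdot>\<^bsub>C\<^esub> \<eta> X)"
      using F.C.Comp_assoc[OF unit_in_Hom[OF XY(1)] G.on_Arr_in_Hom[OF Fu] G.on_Arr_in_Hom[OF h]]
      by (simp add: G.on_Arr_Comp[OF Fu h])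
    also have "\<dots> = on_Arr G h \<cdot>\<^bsub>C\<^esub> \<eta> Y \<cdot>\<^bsub>C\<^esub> u"
      using F.C.Comp_assoc[OF u unit_in_Hom[OF XY(2)] G.on_Arr_in_Hom[OF h]]
      by (simp add: unit_naturality[OF u])
    finally show "\<nu> Z \<cdot>\<^bsub>E\<^esub> on_Arr H (on_Arr G (h \<cdot>\<^bsub>D\<^esub> on_Arr F u) \<cdot>\<^bsub>C\<^esub> \<eta> X) =
        \<nu> Z \<cdot>\<^bsub>E\<^esub> on_Arr H (on_Arr G h \<cdot>\<^bsub>C\<^esub> \<eta> Y) \<cdot>\<^bsub>E\<^esub> on_Arr H u"
      using H.on_Arr_Comp[OF u transpose[OF XY(2) h]]
        H.D.Comp_assoc[OF H.on_Arr_in_Hom[OF u] H.on_Arr_in_Hom[OF transpose[OF XY(2) h]]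
          \<nu>_in_Hom[OF Z]]
      by simp
  next
    fix X v Y Z h
    assume X: "X \<in> Obj C" and v: "v \<in> Hom C Y Z"
      and h: "h \<in> Hom D (on_Obj F X) (on_Obj F Y)"
    note YZ = F.C.Hom_objects[OF v]
    note Fv = F.on_Arr_in_Hom[OF v]
    note GFv = G.on_Arr_in_Hom[OF Fv]
    note t = transpose[OF X h]
    note Ht = H.on_Arr_in_Hom[OF t]
    have "on_Arr G (on_Arr F v \<cdot>\<^bsub>D\<^esub> h) \<cdot>\<^bsub>C\<^esub> \<eta> X =
        on_Arr G (on_Arr F v) \<cdot>\<^bsub>C\<^esub> (on_Arr G h \<cdot>\<^bsub>C\<^esub> \<eta> X)"
      using F.C.Comp_assoc[OF unit_in_Hom[OF X] G.on_Arr_in_Hom[OF h] GFv]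
      by (simp add: G.on_Arr_Comp[OF h Fv])
    then have "\<nu> Z \<cdot>\<^bsub>E\<^esub> on_Arr H (on_Arr G (on_Arr F v \<cdot>\<^bsub>D\<^esub> h) \<cdot>\<^bsub>C\<^esub> \<eta> X) =
        \<nu> Z \<cdot>\<^bsub>E\<^esub> on_Arr H (on_Arr G (on_Arr F v)) \<cdot>\<^bsub>E\<^esub> on_Arr H (on_Arr G h \<cdot>\<^bsub>C\<^esub> \<eta> X)"
      using H.D.Comp_assoc[OF Ht H.on_Arr_in_Hom[OF GFv] \<nu>_in_Hom[OF YZ(2)]]
      by (simp add: H.on_Arr_Comp[OF t GFv])
    also have "\<dots> = on_Arr H v \<cdot>\<^bsub>E\<^esub> \<nu> Y \<cdot>\<^bsub>E\<^esub> on_Arr H (on_Arr G h \<cdot>\<^bsub>C\<^esub> \<eta> X)"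
      by (simp add: \<nu>_naturality[OF v])
    also have "\<dots> = on_Arr H v \<cdot>\<^bsub>E\<^esub> (\<nu> Y \<cdot>\<^bsub>E\<^esub> on_Arr H (on_Arr G h \<cdot>\<^bsub>C\<^esub> \<eta> X))"
      by (rule H.D.Comp_assoc[OF Ht \<nu>_in_Hom[OF YZ(1)] H.on_Arr_in_Hom[OF v]])
    finally show "\<nu> Z \<cdot>\<^bsub>E\<^esub> on_Arr H (on_Arr G (on_Arr F v \<cdot>\<^bsub>D\<^esub> h) \<cdot>\<^bsub>C\<^esub> \<eta> X) =
        on_Arr H v \<cdot>\<^bsub>E\<^esub> (\<nu> Y \<cdot>\<^bsub>E\<^esub> on_Arr H (on_Arr G h \<cdot>\<^bsub>C\<^esub> \<eta> X))" .
  next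
    fix f X Y
    assume f: "f \<in> Hom C X Y"
    note XY = F.C.Hom_objects[OF f]
    have "\<nu> Y \<cdot>\<^bsub>E\<^esub> on_Arr H (on_Arr G (on_Arr F f) \<cdot>\<^bsub>C\<^esub> \<eta> X) =
        \<nu> Y \<cdot>\<^bsub>E\<^esub> on_Arr H (\<eta> Y) \<cdot>\<^bsub>E\<^esub> on_Arr H f"
      using H.D.Comp_assoc[OF H.on_Arr_in_Hom[OF f] H.on_Arr_in_Hom[OF unit_in_Hom[OF XY(2)]]
          \<nu>_in_Hom[OF XY(2)]] H.on_Arr_Comp[OF f unit_in_Hom[OF XY(2)]]
      by (simp add: unit_naturality[OF f])
    also have "\<dots> = on_Arr H f"
      by (simp add: split[OF XY(2)] H.D.Comp_Ident_left[OF H.on_Arr_in_Hom[OF f]])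
    finally show "\<nu> Y \<cdot>\<^bsub>E\<^esub> on_Arr H (on_Arr G (on_Arr F f) \<cdot>\<^bsub>C\<^esub> \<eta> X) = on_Arr H f" .
  qed
qed

theorem separable_left_adjoint_iff:
  assumes "cfunctor C E H"
  shows "separable C D E F H \<longleftrightarrow>
    (\<exists>\<nu>. natural_transformation C E (H \<circ>\<^sub>F G \<circ>\<^sub>F F) H \<nu> \<and>
      (\<forall>X \<in> Obj C. \<nu> X \<cdot>\<^bsub>E\<^esub> on_Arr H (\<eta> X) = Ident E (on_Obj H X)))"
  unfolding separable_iff_separating_family[OF F.cfunctor_axioms assms]
  using splitting_of_separating_family separating_family_of_splitting[OF assms] by blast

end

section \<open>Opposite categories\<close>

definition opposite :: "('o, 'm) category \<Rightarrow> ('o, 'm) category" where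
  "opposite C = \<lparr>Obj = Obj C, Arr = Arr C, Dom = Cod C, Cod = Dom C, Ident = Ident C,
     Comp = (\<lambda>g f. f \<cdot>\<^bsub>C\<^esub> g)\<rparr>"

lemma opposite_simps [simp]:
  "Obj (opposite C) = Obj C"
  "Ident (opposite C) = Ident C"
  "g \<cdot>\<^bsub>opposite C\<^esub> f = f \<cdot>\<^bsub>C\<^esub> g"
  "Hom (opposite C) X Y = Hom C Y X"
  by (auto simp: opposite_def Hom_def)

lemma opposite_opposite [simp]: "opposite (opposite C) = C"
  by (simp add: opposite_def)

lemma category_opposite:
  assumes "category C"
  shows "category (opposite C)"
proof -
  interpret category C by fact
  show ?thesis
  proof unfold_locales
    fix f assume "f \<in> Arr (opposite C)"
    then show "Dom (opposite C) f \<in> Obj (opposite C)" "Cod (opposite C) f \<in> Obj (opposite C)"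
      by (simp_all add: opposite_def Dom_in_Obj Cod_in_Obj)
  next
    fix f g X Y Z
    assume "f \<in> Hom (opposite C) X Y" and "g \<in> Hom (opposite C) Y Z"
    then show "g \<cdot>\<^bsub>opposite C\<^esub> f \<in> Hom (opposite C) X Z"
      using Comp_in_Hom[of g Z Y f X] by simp
  next
    fix f g h W X Y Z
    assume "f \<in> Hom (opposite C) W X" and "g \<in> Hom (opposite C) X Y"
      and "h \<in> Hom (opposite C) Y Z"
    then show "h \<cdot>\<^bsub>opposite C\<^esub> g \<cdot>\<^bsub>opposite C\<^esub> f =
        h \<cdot>\<^bsub>opposite C\<^esub> (g \<cdot>\<^bsub>opposite C\<^esub> f)"
      using Comp_assoc[of h Z Y g X f W] by simp
  qed (simp_all add: Ident_in_Hom Comp_Ident_left Comp_Ident_right)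
qed

text \<open>A functor and its opposite consist of the same two maps, so both are written \<open>F\<close>.\<close>

lemma cfunctor_opposite:
  assumes "cfunctor C D F"
  shows "cfunctor (opposite C) (opposite D) F"
proof -
  interpret cfunctor C D F by fact
  interpret C': category "opposite C" by (rule category_opposite[OF C.category_axioms])
  interpret D': category "opposite D" by (rule category_opposite[OF D.category_axioms])
  show ?thesis
    by unfold_locales (auto intro: on_Obj_in_Obj on_Arr_in_Hom on_Arr_Ident on_Arr_Comp)
qed

lemma natural_transformation_opposite:
  assumes "natural_transformation C D F G \<tau>"
  shows "natural_transformation (opposite C) (opposite D) G F \<tau>"
proof -
  interpret natural_transformation C D F G \<tau> by fact
  interpret F': cfunctor "opposite C" "opposite D" F
    by (rule cfunctor_opposite[OF F.cfunctor_axioms])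
  interpret G': cfunctor "opposite C" "opposite D" G
    by (rule cfunctor_opposite[OF G.cfunctor_axioms])
  show ?thesis
    by unfold_locales (auto simp: component_in_Hom naturality)
qed

lemma natural_transformation_opposite_iff:
  "natural_transformation (opposite C) (opposite D) G F \<tau> \<longleftrightarrow> natural_transformation C D F G \<tau>"
  using natural_transformation_opposite[of C D F G \<tau>]
    natural_transformation_opposite[of "opposite C" "opposite D" G F \<tau>] by auto

text \<open>
  Reversing arrows turns the unit into a counit and exchanges the triangle identities, so the right
  adjoint becomes the left one.
\<close>

lemma adjunction_opposite:
  assumes "adjunction C D F G \<eta> \<epsilon>"
  shows "adjunction (opposite D) (opposite C) G F \<epsilon> \<eta>"
proof -
  interpret adjunction C D F G \<eta> \<epsilon> by fact
  show ?thesis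
    by (intro adjunction.intro adjunction_axioms.intro cfunctor_opposite
        natural_transformation_opposite F.cfunctor_axioms G.cfunctor_axioms
        unit.natural_transformation_axioms counit.natural_transformation_axioms)
      (simp_all add: triangle_left triangle_right)
qed

lemma separating_family_opposite:
  assumes "separating_family C D E F H P"
  shows "separating_family (opposite C) (opposite D) (opposite E) F H (\<lambda>X Y. P Y X)"
proof -
  interpret separating_family C D E F H P by fact
  interpret F': cfunctor "opposite C" "opposite D" F
    by (rule cfunctor_opposite[OF F.cfunctor_axioms])
  interpret H': cfunctor "opposite C" "opposite E" H
    by (rule cfunctor_opposite[OF H.cfunctor_axioms])
  show ?thesis
    by unfold_locales (auto simp: P_in_Hom P_precomp P_postcomp P_on_image)
qed

lemma separable_opposite_iff:
  assumes "cfunctor C D F" and "cfunctor C E H"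
  shows "separable (opposite C) (opposite D) (opposite E) F H \<longleftrightarrow> separable C D E F H"
proof -
  have "(\<exists>P. separating_family (opposite C) (opposite D) (opposite E) F H P) \<longleftrightarrow>
      (\<exists>P. separating_family C D E F H P)"
    using separating_family_opposite[of C D E F H]
      separating_family_opposite[of "opposite C" "opposite D" "opposite E" F H] by fastforce
  then show ?thesis
    by (simp add: separable_iff_separating_family assms cfunctor_opposite)
qed

section \<open>Separability of both adjoints\<close>

theorem theorem3p7:
  fixes C :: "('oc, 'mc) category" and D :: "('od, 'md) category" and E :: "('oe, 'me) category"
    and F :: "('oc, 'mc, 'od, 'md) cfunctor" and G :: "('od, 'md, 'oc, 'mc) cfunctor"
    and H :: "('oc, 'mc, 'oe, 'me) cfunctor" and K :: "('od, 'md, 'oe, 'me) cfunctor"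
    and \<eta> :: "'oc \<Rightarrow> 'mc" and \<epsilon> :: "'od \<Rightarrow> 'md"
  assumes "adjunction C D F G \<eta> \<epsilon>"
    and "cfunctor C E H"
    and "cfunctor D E K"
  shows "(separable C D E F H \<longleftrightarrow>
            (\<exists>\<nu>. natural_transformation C E (H \<circ>\<^sub>F G \<circ>\<^sub>F F) H \<nu> \<and>
              (\<forall>X \<in> Obj C. \<nu> X \<cdot>\<^bsub>E\<^esub> on_Arr H (\<eta> X) = Ident E (on_Obj H X)))) \<and>
         (separable D C E G K \<longleftrightarrow>
            (\<exists>\<zeta>. natural_transformation D E K (K \<circ>\<^sub>F F \<circ>\<^sub>F G) \<zeta> \<and>
              (\<forall>Y \<in> Obj D. on_Arr K (\<epsilon> Y) \<cdot>\<^bsub>E\<^esub> \<zeta> Y = Ident E (on_Obj K Y))))"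
proof
  interpret adjunction C D F G \<eta> \<epsilon> by (rule assms(1))
  show "separable C D E F H \<longleftrightarrow>
      (\<exists>\<nu>. natural_transformation C E (H \<circ>\<^sub>F G \<circ>\<^sub>F F) H \<nu> \<and>
        (\<forall>X \<in> Obj C. \<nu> X \<cdot>\<^bsub>E\<^esub> on_Arr H (\<eta> X) = Ident E (on_Obj H X)))"
    by (rule separable_left_adjoint_iff[OF assms(2)])
  interpret op: adjunction "opposite D" "opposite C" G F \<epsilon> \<eta>
    by (rule adjunction_opposite[OF assms(1)])
  show "separable D C E G K \<longleftrightarrow>
      (\<exists>\<zeta>. natural_transformation D E K (K \<circ>\<^sub>F F \<circ>\<^sub>F G) \<zeta> \<and>
        (\<forall>Y \<in> Obj D. on_Arr K (\<epsilon> Y) \<cdot>\<^bsub>E\<^esub> \<zeta> Y = Ident E (on_Obj K Y)))"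
    using op.separable_left_adjoint_iff[OF cfunctor_opposite[OF assms(3)]]
    by (simp add: separable_opposite_iff[OF G.cfunctor_axioms assms(3)]
        natural_transformation_opposite_iff)
qed

end
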